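(* Let $a>0$, $\lambda>0$, $x\in\mathbb{R}^n$, let $D$ be an $n\times n$ diagonal matrix whose diagonal elements $d_1,\dots,d_n$ are positive, and let $g_1(x)=\sum_{i=1}^n\min\{a|x_i|,1\}$ be the capped $\ell_1$ norm. Then $$\operatorname{prox}_{\lambda g_1}^D(x)=\prod_{i=1}^n\operatorname{prox}_{\lambda\min\{a|\cdot|,1\}}^{d_i}(x_i)$$ (Cartesian product of sets), where $$\operatorname{prox}_{\lambda\min\{a|\cdot|,1\}}^{d_i}(x_i)=\begin{cases}\{\mathcal{S}_{\lambda a/d_i}(x_i)\}, &\left(|x_i|\le\frac{\lambda a}{d_i}\text{ and }|x_i|<\sqrt{\frac{2\lambda}{d_i}}\right)\text{ or }\left(\frac{\lambda a}{d_i}<|x_i|<\frac{\lambda a}{2d_i}+\frac1a\right),\\[4pt] \{x_i,\mathcal{S}_{\lambda a/d_i}(x_i)\}, &\left(|x_i|=\sqrt{\frac{2\lambda}{d_i}}\le\frac{\lambda a}{d_i}\right)\text{ or }\left(|x_i|=\frac{\lambda a}{2d_i}+\frac1a>\frac{\lambda a}{d_i}\right),\\[4pt] \{x_i\}, &\left(\sqrt{\frac{2\lambda}{d_i}}<|x_i|\le\frac{\lambda a}{d_i}\right)\text{ or }\left(|x_i|>\max\left\{\frac{\lambda a}{d_i},\frac{\lambda a}{2d_i}+\frac1a\right\}\right),\end{cases}$$ and $\mathcal{S}_c(\xi)=\operatorname{sign}(\xi)\max\{|\xi|-c,0\}$.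
   Context: For a function $h:\mathbb{R}^n\to(-\infty,\infty]$ and a positive definite matrix $A$, the scaled proximal mapping is the set $\operatorname{prox}_h^A(x)=\operatorname{argmin}_{y\in\mathbb{R}^n}\{h(y)+\frac12\|y-x\|_A^2\}$, where $\|z\|_A=\sqrt{z^\top Az}$. In dimension one with $A=d>0$ this is $\operatorname{argmin}_{y\in\mathbb{R}}\{h(y)+\frac d2(y-x)^2\}$. *)

theory Defs
  imports "HOL-Analysis.Analysis"
begin

definition scaled_norm :: "real ^ 'n ^ 'n \<Rightarrow> real ^ 'n \<Rightarrow> real" where
  "scaled_norm A z = sqrt (z \<bullet> (A *v z))"

(* Meant for positive definite A and for h not taking the value -\<infinity>.
   The result is the set of all global minimizers. *)
definition prox :: "real ^ 'n ^ 'n \<Rightarrow> (real ^ 'n \<Rightarrow> ereal) \<Rightarrow> real ^ 'n \<Rightarrow> (real ^ 'n) set" where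
  "prox A h x =
     {y. is_arg_min (\<lambda>y. h y + ereal (1/2 * (scaled_norm A (y - x))\<^sup>2)) (\<lambda>_. True) y}"

(* The same mapping in dimension one, with the scaling matrix a number d > 0. *)
definition prox1 :: "real \<Rightarrow> (real \<Rightarrow> ereal) \<Rightarrow> real \<Rightarrow> real set" where
  "prox1 d h x = {y. is_arg_min (\<lambda>y. h y + ereal (d/2 * (y - x)\<^sup>2)) (\<lambda>_. True) y}"

definition capped_l1 :: "real \<Rightarrow> real ^ 'n \<Rightarrow> real" where
  "capped_l1 a x = (\<Sum>i\<in>UNIV. min (a * \<bar>x $ i\<bar>) 1)"

definition soft_threshold :: "real \<Rightarrow> real \<Rightarrow> real" where
  "soft_threshold c \<xi> = sgn \<xi> * max (\<bar>\<xi>\<bar> - c) 0"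

end

theory Submission
  imports Defs
begin

text \<open>
  The objective is a sum of functions of the single coordinates, so it is minimized coordinatewise.
  In dimension one the objective is the pointwise minimum of
  \<open>p y = lam a \<bar>y\<bar> + d/2 (y - x)^2\<close> and \<open>q y = lam + d/2 (y - x)^2\<close>. These have unique minimizers,
  the soft threshold \<open>S\<close> of \<open>x\<close> and \<open>x\<close> itself, so the three cases of the theorem
  are \<open>p S < q x\<close>, \<open>p S = q x\<close> and \<open>p S > q x\<close>.
\<close>

lemma mem_prox1_real:
  "y \<in> prox1 d (\<lambda>t. ereal (h t)) x \<longleftrightarrow> (\<forall>t. h y + d/2 * (y - x)\<^sup>2 \<le> h t + d/2 * (t - x)\<^sup>2)"
  by (simp add: prox1_def is_arg_min_def not_less)

lemma mem_prox_real:
  "y \<in> prox A (\<lambda>t. ereal (h t)) x \<longleftrightarrow>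
     (\<forall>t. h y + 1/2 * (scaled_norm A (y - x))\<^sup>2 \<le> h t + 1/2 * (scaled_norm A (t - x))\<^sup>2)"
  by (simp add: prox_def is_arg_min_def not_less)

text \<open>Nonnegative diagonal entries make the quadratic form nonnegative, so squaring undoes the
  square root in \<open>scaled_norm\<close>.\<close>

lemma scaled_norm_diagonal:
  fixes D :: "real ^ 'n ^ 'n"
  assumes "\<And>i j. i \<noteq> j \<Longrightarrow> D $ i $ j = 0" and "\<And>i. D $ i $ i = d i" and "\<And>i. d i \<ge> 0"
  shows "(scaled_norm D z)\<^sup>2 = (\<Sum>i\<in>UNIV. d i * (z $ i)\<^sup>2)"
proof -
  have "(\<Sum>j\<in>UNIV. D $ i $ j * z $ j) = d i * z $ i" for i
  proof -
    have "(\<Sum>j\<in>UNIV. D $ i $ j * z $ j) = (\<Sum>j\<in>UNIV. if j = i then d i * z $ i else 0)"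
      using assms(1,2) by (intro sum.cong) auto
    then show ?thesis by simp
  qed
  then have "z \<bullet> (D *v z) = (\<Sum>i\<in>UNIV. d i * (z $ i)\<^sup>2)"
    by (simp add: inner_vec_def matrix_vector_mult_def power2_eq_square algebra_simps)
  moreover have "(\<Sum>i\<in>UNIV. d i * (z $ i)\<^sup>2) \<ge> 0"
    using assms(3) by (intro sum_nonneg) simp
  ultimately show ?thesis
    by (simp add: scaled_norm_def)
qed

text \<open>Comparing \<open>y\<close> with a vector that differs from it in one coordinate only
  cancels all other summands. The converse sums the coordinatewise inequalities.\<close>

lemma separable_minimizer_iff:
  fixes f :: "'n::finite \<Rightarrow> 'a \<Rightarrow> real" and y :: "'a ^ 'n"
  shows "(\<forall>t :: 'a ^ 'n. (\<Sum>i\<in>UNIV. f i (y $ i)) \<le> (\<Sum>i\<in>UNIV. f i (t $ i))) \<longleftrightarrow>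
         (\<forall>i s. f i (y $ i) \<le> f i s)"
proof (intro iffI allI)
  fix i s
  assume min: "\<forall>t :: 'a ^ 'n. (\<Sum>i\<in>UNIV. f i (y $ i)) \<le> (\<Sum>i\<in>UNIV. f i (t $ i))"
  define t where "t = (\<chi> j. if j = i then s else y $ j)"
  have "(\<Sum>j\<in>UNIV. f j (y $ j)) = f i (y $ i) + (\<Sum>j\<in>UNIV - {i}. f j (y $ j))"
    by (simp add: sum.remove)
  moreover have "(\<Sum>j\<in>UNIV. f j (t $ j)) = f i (t $ i) + (\<Sum>j\<in>UNIV - {i}. f j (t $ j))"
    by (simp add: sum.remove)
  moreover have "(\<Sum>j\<in>UNIV - {i}. f j (t $ j)) = (\<Sum>j\<in>UNIV - {i}. f j (y $ j))"
    by (intro sum.cong) (auto simp: t_def)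
  moreover have "f i (t $ i) = f i s"
    by (simp add: t_def)
  ultimately show "f i (y $ i) \<le> f i s"
    using min[rule_format, of t] by linarith
qed (simp add: sum_mono)

lemma prox_separable:
  fixes D :: "real ^ 'n ^ 'n"
  assumes "\<And>i j. i \<noteq> j \<Longrightarrow> D $ i $ j = 0" and "\<And>i. D $ i $ i = d i" and "\<And>i. d i \<ge> 0"
  shows "prox D (\<lambda>z. ereal (\<Sum>i\<in>UNIV. h i (z $ i))) x =
         {y. \<forall>i. y $ i \<in> prox1 (d i) (\<lambda>t. ereal (h i t)) (x $ i)}"
proof -
  have "(\<Sum>i\<in>UNIV. h i (y $ i)) + 1/2 * (scaled_norm D (y - x))\<^sup>2 =
        (\<Sum>i\<in>UNIV. h i (y $ i) + d i / 2 * (y $ i - x $ i)\<^sup>2)" for y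
    by (simp add: scaled_norm_diagonal[OF assms] sum.distrib sum_divide_distrib)
  then show ?thesis
    using separable_minimizer_iff[of "\<lambda>i t. h i t + d i / 2 * (t - x $ i)\<^sup>2"]
    by (simp add: set_eq_iff mem_prox_real mem_prox1_real del: times_divide_eq_left)
qed

text \<open>The least value of the pointwise minimum is \<open>min (p u) (q w)\<close>. It can be
  reached only through \<open>p\<close> at \<open>u\<close> or through \<open>q\<close> at
  \<open>w\<close>, by strictness. The points \<open>u\<close> and \<open>w\<close> may
  coincide.\<close>

lemma argmin_min:
  fixes p q :: "'a \<Rightarrow> 'b::linorder"
  assumes "\<And>y. y \<noteq> u \<Longrightarrow> p u < p y" and "\<And>y. y \<noteq> w \<Longrightarrow> q w < q y"
  shows "{y. \<forall>t. min (p y) (q y) \<le> min (p t) (q t)} =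
         (if p u < q w then {u} else if p u = q w then {u, w} else {w})"
proof -
  have p: "p u \<le> p y" and q: "q w \<le> q y" for y
    using assms(1)[of y] assms(2)[of y] by (cases "y = u"; cases "y = w"; simp)+
  \<comment> \<open>Testing \<open>t = u\<close> and \<open>t = w\<close> suffices.\<close>
  have "(\<forall>t. min (p y) (q y) \<le> min (p t) (q t)) \<longleftrightarrow> min (p y) (q y) \<le> min (p u) (q w)" for y
    using p q by (meson min.bounded_iff min.coboundedI1 min.coboundedI2 min.mono order_refl order_trans)
  moreover have "min (p y) (q y) \<le> min (p u) (q w) \<longleftrightarrow>
      (y = u \<and> p u \<le> q w) \<or> (y = w \<and> q w \<le> p u)" for y
    using assms(1)[of y] assms(2)[of y] p[of y] q[of y]
    by (cases "y = u"; cases "y = w") (auto simp: min_le_iff_disj)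
  ultimately show ?thesis
    by (auto simp: set_eq_iff)
qed

text \<open>The two facts say that \<open>\<xi> - S\<close> lies in \<open>c\<close> times the subdifferential of the absolute value
  at \<open>S\<close>.\<close>

lemma soft_threshold_subgradient:
  fixes c \<xi> :: real
  assumes "c \<ge> 0"
  defines "S \<equiv> soft_threshold c \<xi>"
  shows "\<bar>\<xi> - S\<bar> \<le> c" and "(\<xi> - S) * S = c * \<bar>S\<bar>"
  using assms(1) unfolding S_def soft_threshold_def sgn_if max_def
  by (auto simp: abs_if algebra_simps)

text \<open>Since \<open>x - S\<close> is a subgradient of \<open>c\<close> times the absolute value
  at \<open>S\<close>, the increase of that term from \<open>S\<close> to \<open>y\<close> is at
  least \<open>(x - S) * (y - S)\<close>. Expanding \<open>(y - x)\<^sup>2 / 2\<close> around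
  \<open>S\<close> gives the opposite linear term and the surplus
  \<open>(y - S)\<^sup>2 / 2\<close>, which later yields uniqueness.\<close>

lemma soft_threshold_quadratic_growth:
  fixes c x y :: real
  assumes "c \<ge> 0"
  defines "S \<equiv> soft_threshold c x"
  shows "c * \<bar>S\<bar> + (S - x)\<^sup>2 / 2 + (y - S)\<^sup>2 / 2 \<le> c * \<bar>y\<bar> + (y - x)\<^sup>2 / 2"
proof -
  have "(x - S) * y \<le> \<bar>x - S\<bar> * \<bar>y\<bar>"
    by (metis abs_ge_self abs_mult)
  also have "\<dots> \<le> c * \<bar>y\<bar>"
    using soft_threshold_subgradient(1)[OF assms(1)] by (simp add: S_def mult_right_mono)
  finally have "(x - S) * y - (x - S) * S \<le> c * \<bar>y\<bar> - c * \<bar>S\<bar>"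
    using soft_threshold_subgradient(2)[OF assms(1)] by (simp add: S_def)
  then show ?thesis
    by (simp add: power2_eq_square field_simps)
qed

lemma soft_threshold_unique_minimizer:
  assumes "c \<ge> 0" and "y \<noteq> soft_threshold c x"
  shows "c * \<bar>soft_threshold c x\<bar> + (soft_threshold c x - x)\<^sup>2 / 2 < c * \<bar>y\<bar> + (y - x)\<^sup>2 / 2"
proof -
  have "(y - soft_threshold c x)\<^sup>2 > 0"
    using assms(2) by simp
  then show ?thesis
    using soft_threshold_quadratic_growth[OF assms(1), of x y] by linarith
qed

text \<open>The right-hand side is the Huber function of \<open>x\<close> with threshold
  \<open>c\<close>, the Moreau envelope of \<open>c\<close> times the absolute value.\<close>

lemma soft_threshold_min_value:
  assumes "c \<ge> 0"
  shows "c * \<bar>soft_threshold c x\<bar> + (soft_threshold c x - x)\<^sup>2 / 2 =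
         (if \<bar>x\<bar> \<le> c then x\<^sup>2 / 2 else c * \<bar>x\<bar> - c\<^sup>2 / 2)"
  using assms unfolding soft_threshold_def sgn_if max_def
  by (auto simp: abs_if power2_eq_square field_simps)

lemma prox1_capped_abs:
  fixes a lam d x :: real
  assumes "a > 0" "lam > 0" "d > 0"
  defines "c \<equiv> lam * a / d"
  defines "S \<equiv> soft_threshold c x"
  defines "v \<equiv> if \<bar>x\<bar> \<le> c then x\<^sup>2 / 2 else c * \<bar>x\<bar> - c\<^sup>2 / 2"
  shows "prox1 d (\<lambda>t. ereal (lam * min (a * \<bar>t\<bar>) 1)) x =
         (if v < lam / d then {S} else if v = lam / d then {S, x} else {x})"
proof -
  have "c \<ge> 0"
    using assms by simp
  \<comment> \<open>These are the two branches of the objective divided by \<open>d\<close>. The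
    positive factor does not affect minimizers, and it turns the weight of the absolute value into
    \<open>c = lam * a / d\<close>.\<close>
  define p where "p y = c * \<bar>y\<bar> + (y - x)\<^sup>2 / 2" for y
  define q where "q y = lam / d + (y - x)\<^sup>2 / 2" for y
  have "lam * min (a * \<bar>t\<bar>) 1 + d / 2 * (t - x)\<^sup>2 = d * min (p t) (q t)" for t
    using assms(2,3) by (simp add: p_def q_def c_def min_mult_distrib_left min_add_distrib_left distrib_left)
  then have "prox1 d (\<lambda>t. ereal (lam * min (a * \<bar>t\<bar>) 1)) x = {y. \<forall>t. min (p y) (q y) \<le> min (p t) (q t)}"
    using assms(3) by (simp only: set_eq_iff mem_prox1_real mem_Collect_eq mult_le_cancel_left_pos simp_thms)
  also have "\<dots> = (if p S < q x then {S} else if p S = q x then {S, x} else {x})"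
    using soft_threshold_unique_minimizer[OF \<open>c \<ge> 0\<close>, of _ x]
    by (intro argmin_min) (auto simp: p_def q_def S_def)
  also have "p S = v"
    using soft_threshold_min_value[OF \<open>c \<ge> 0\<close>, of x] by (simp add: p_def S_def v_def)
  also have "q x = lam / d"
    by (simp add: q_def)
  finally show ?thesis .
qed

text \<open>Used for \<open>\<bar>x\<bar> \<le> c\<close>, where the soft threshold is zero. In HOL
  \<open>sqrt\<close> is strictly increasing on all reals, so \<open>m\<close> may have any
  sign.\<close>

lemma half_square_cmp_iff:
  fixes x m :: real
  shows "x\<^sup>2 / 2 < m \<longleftrightarrow> \<bar>x\<bar> < sqrt (2 * m)" and "x\<^sup>2 / 2 = m \<longleftrightarrow> \<bar>x\<bar> = sqrt (2 * m)"
proof -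
  have *: "\<bar>x\<bar> = sqrt (x\<^sup>2)"
    by simp
  show "x\<^sup>2 / 2 < m \<longleftrightarrow> \<bar>x\<bar> < sqrt (2 * m)" "x\<^sup>2 / 2 = m \<longleftrightarrow> \<bar>x\<bar> = sqrt (2 * m)"
    unfolding * real_sqrt_less_iff real_sqrt_eq_iff by auto
qed

text \<open>Used for \<open>\<bar>x\<bar> > c\<close>, with \<open>m = lam / d\<close> and
  \<open>c = m * a\<close>. The difference of the two sides factors as \<open>m * a\<close> times
  \<open>t - (m * a / 2 + 1 / a)\<close>, which is where the second threshold comes from.\<close>

lemma soft_threshold_value_cmp_iff:
  fixes a m t :: real
  assumes "a > 0" "m > 0"
  shows "m * a * t - (m * a)\<^sup>2 / 2 < m \<longleftrightarrow> t < m * a / 2 + 1 / a"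
    and "m * a * t - (m * a)\<^sup>2 / 2 = m \<longleftrightarrow> t = m * a / 2 + 1 / a"
proof -
  have "m * a * t - (m * a)\<^sup>2 / 2 - m = m * a * (t - (m * a / 2 + 1 / a))"
    using assms by (simp add: field_simps power2_eq_square)
  moreover have "m * a > 0"
    using assms by simp
  ultimately show "m * a * t - (m * a)\<^sup>2 / 2 < m \<longleftrightarrow> t < m * a / 2 + 1 / a"
    "m * a * t - (m * a)\<^sup>2 / 2 = m \<longleftrightarrow> t = m * a / 2 + 1 / a"
    by (smt (verit) mult_pos_neg mult_nonneg_nonneg mult_eq_0_iff)+
qed

text \<open>The three conditions are the trichotomy of \<open>v\<close> against
  \<open>lam / d\<close>, written out on either side of \<open>\<bar>x\<bar> = c\<close>. Hence they
  are exhaustive and mutually exclusive.\<close>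

lemma prox1_capped_abs_cases:
  fixes a lam d x :: real
  assumes "a > 0" "lam > 0" "d > 0"
  defines "P \<equiv> prox1 d (\<lambda>t. ereal (lam * min (a * \<bar>t\<bar>) 1)) x"
    and "S \<equiv> soft_threshold (lam * a / d) x"
  defines "C1 \<equiv> (\<bar>x\<bar> \<le> lam * a / d \<and> \<bar>x\<bar> < sqrt (2 * lam / d)
                 \<or> lam * a / d < \<bar>x\<bar> \<and> \<bar>x\<bar> < lam * a / (2 * d) + 1 / a)"
    and "C2 \<equiv> (\<bar>x\<bar> = sqrt (2 * lam / d) \<and> sqrt (2 * lam / d) \<le> lam * a / d
                 \<or> \<bar>x\<bar> = lam * a / (2 * d) + 1 / a \<and> lam * a / (2 * d) + 1 / a > lam * a / d)"
    and "C3 \<equiv> (sqrt (2 * lam / d) < \<bar>x\<bar> \<and> \<bar>x\<bar> \<le> lam * a / d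
                 \<or> \<bar>x\<bar> > max (lam * a / d) (lam * a / (2 * d) + 1 / a))"
  shows "(C1 \<longrightarrow> P = {S}) \<and> (C2 \<longrightarrow> P = {x, S}) \<and> (C3 \<longrightarrow> P = {x}) \<and> (C1 \<or> C2 \<or> C3)"
proof -
  define c where "c = lam * a / d"
  define v where "v = (if \<bar>x\<bar> \<le> c then x\<^sup>2 / 2 else c * \<bar>x\<bar> - c\<^sup>2 / 2)"
  have P: "P = (if v < lam / d then {S} else if v = lam / d then {S, x} else {x})"
    using prox1_capped_abs[OF assms(1-3)] by (simp add: P_def S_def v_def c_def)
  have m: "lam / d > 0"
    using assms by simp
  have c: "lam / d * a = c" "lam * a / (2 * d) = c / 2"
    by (simp_all add: c_def)
  note low = half_square_cmp_iff[of x "lam / d", simplified]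
  note high = soft_threshold_value_cmp_iff[OF assms(1) m, of "\<bar>x\<bar>", unfolded c(1)]
  have C1: "C1 \<longleftrightarrow> v < lam / d"
    using low(1) high(1) by (auto simp: C1_def v_def c(2) simp flip: c_def)
  have C2: "C2 \<longleftrightarrow> v = lam / d"
    using low(2) high(2) by (auto simp: C2_def v_def c(2) simp flip: c_def)
  have C3: "C3 \<longleftrightarrow> v > lam / d"
    \<comment> \<open>In the second alternative of \<open>C3\<close>, the first argument of
      \<open>max\<close> selects the linear branch of \<open>v\<close>.\<close>
    using low high by (auto simp: C3_def v_def c(2) not_less not_le simp flip: c_def)
  show ?thesis
    unfolding P C1 C2 C3 by auto
qed

theorem proposition3p1:
  fixes a lam :: real and x :: "real ^ 'n" and D :: "real ^ 'n ^ 'n" and d :: "'n \<Rightarrow> real"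
  assumes "a > 0" and "lam > 0"
    and "\<And>i j. i \<noteq> j \<Longrightarrow> D $ i $ j = 0"
    and "\<And>i. D $ i $ i = d i"
    and "\<And>i. d i > 0"
  shows "prox D (\<lambda>z. ereal (lam * capped_l1 a z)) x
           = {y. \<forall>i. y $ i \<in> prox1 (d i) (\<lambda>t. ereal (lam * min (a * \<bar>t\<bar>) 1)) (x $ i)}
       \<and> (\<forall>i. let P = prox1 (d i) (\<lambda>t. ereal (lam * min (a * \<bar>t\<bar>) 1)) (x $ i);
                  S = soft_threshold (lam * a / d i) (x $ i);
                  C1 = (\<bar>x $ i\<bar> \<le> lam * a / d i \<and> \<bar>x $ i\<bar> < sqrt (2 * lam / d i)
                        \<or> lam * a / d i < \<bar>x $ i\<bar> \<and> \<bar>x $ i\<bar> < lam * a / (2 * d i) + 1 / a);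
                  C2 = (\<bar>x $ i\<bar> = sqrt (2 * lam / d i) \<and> sqrt (2 * lam / d i) \<le> lam * a / d i
                        \<or> \<bar>x $ i\<bar> = lam * a / (2 * d i) + 1 / a
                          \<and> lam * a / (2 * d i) + 1 / a > lam * a / d i);
                  C3 = (sqrt (2 * lam / d i) < \<bar>x $ i\<bar> \<and> \<bar>x $ i\<bar> \<le> lam * a / d i
                        \<or> \<bar>x $ i\<bar> > max (lam * a / d i) (lam * a / (2 * d i) + 1 / a))
              in (C1 \<longrightarrow> P = {S}) \<and> (C2 \<longrightarrow> P = {x $ i, S}) \<and> (C3 \<longrightarrow> P = {x $ i})
                 \<and> (C1 \<or> C2 \<or> C3))"
proof (intro conjI allI)
  have "lam * capped_l1 a z = (\<Sum>i\<in>UNIV. lam * min (a * \<bar>z $ i\<bar>) 1)" for z :: "real ^ 'n"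
    by (simp add: capped_l1_def sum_distrib_left)
  then show "prox D (\<lambda>z. ereal (lam * capped_l1 a z)) x
      = {y. \<forall>i. y $ i \<in> prox1 (d i) (\<lambda>t. ereal (lam * min (a * \<bar>t\<bar>) 1)) (x $ i)}"
    using prox_separable[of D d "\<lambda>_ t. lam * min (a * \<bar>t\<bar>) 1" x] assms(3-5)
    by (simp add: less_imp_le)
qed (unfold Let_def, rule prox1_capped_abs_cases[OF assms(1,2,5)])

end
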